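(* Let $\mathbf d=(2,\dots,2,1)$ be a binary architecture with $L\ge2$ weight matrices and single output, and let $\sigma(x)=1/x$. Then the neurovariety $\mathcal V_{\mathbf d,\sigma}(\mathbb C)$ is filling, i.e. $$\mathcal V_{\mathbf d,\sigma}(\mathbb C)=S^{n(\mathbf d)}(\mathbb C^2)\times S^{m(\mathbf d)}(\mathbb C^2).$$
   Context: $S^d(\mathbb C^2)$ is the space of complex binary forms of degree $d$. For a binary architecture $\mathbf d=(2,\dots,2,d_L)$ with complex weights $\mathbf w=(W_1,\dots,W_L)$, $W_1,\dots,W_{L-1}\in\mathbb C^{2\times2}$, $W_L\in\mathbb C^{d_L\times2}$, put $P_{12}=\begin{pmatrix}0&1\\1&0\end{pmatrix}$, $p_i(\mathbf x)=(W_iP_{12}W_{i-1}\cdots P_{12}W_1)\mathbf x$ for $1\le i\le L$ with $j$-th entry $p_{j,i}$, $q_0=q_1=1$, and $q_{i+1}=p_{1,i}p_{2,i}$ for $1\le i\le L-1$. Let $$P_{i,\mathbf w}=p_{i,L}\,q_{L-1}q_{L-3}\cdots q_{\delta(L+1)},\qquad Q_{\mathbf w}=q_Lq_{L-2}\cdots q_{\delta(L)},$$ where $\delta(n)\in\{0,1\}$ is the parity of $n$ ($0$ if even, $1$ if odd). These are the numerators and the common denominator of the network $W_L\circ\sigma\circ\cdots\circ\sigma\circ W_1$ ($\sigma$ entrywise), and are forms of degrees $n(\mathbf d)=L+\delta(L)-1$ and $m(\mathbf d)=L-\delta(L)$. The neuromanifold $\mathcal M_{\mathbf d,\sigma}(\mathbb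 C)$ is the image of $\mathbf w\mapsto(P_{1,\mathbf w},\dots,P_{d_L,\mathbf w},Q_{\mathbf w})\in(S^{n(\mathbf d)}(\mathbb C^2))^{d_L}\times S^{m(\mathbf d)}(\mathbb C^2)$ over all complex weights, and the neurovariety $\mathcal V_{\mathbf d,\sigma}(\mathbb C)$ is its Zariski closure. *)

theory Defs
  imports "HOL-Analysis.Analysis" "HOL-Library.Poly_Mapping"
begin

text \<open>
  The polynomial ring in two variables over the complex numbers, as the monoid algebra of
  \<open>nat \<times> nat\<close>: the key \<open>(a, b)\<close> stands for the monomial \<open>x\<^sub>1\<^sup>a x\<^sub>2\<^sup>b\<close>.
\<close>

type_synonym bipoly = "(nat \<times> nat) \<Rightarrow>\<^sub>0 complex"

definition binary_forms :: "nat \<Rightarrow> bipoly set" where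
  "binary_forms d = {f. \<forall>k \<in> Poly_Mapping.keys f. fst k + snd k = d}"

definition linear_form :: "complex ^ 2 \<Rightarrow> bipoly" where
  "linear_form r = Poly_Mapping.single (1, 0) (r $ 1) + Poly_Mapping.single (0, 1) (r $ 2)"

text \<open>
  The weights of a network of architecture \<open>(2, \<dots>, 2, d\<^sub>L)\<close> are a sequence \<open>W\<close>, of which only
  \<open>W 1, \<dots>, W (L - 1)\<close> are used, and a final matrix \<open>V\<close> with two columns and rows indexed by a
  finite type with \<open>d\<^sub>L\<close> elements.
\<close>

definition P12 :: "complex ^ 2 ^ 2" where
  "P12 = vector [vector [0, 1], vector [1, 0]]"

text \<open>The product \<open>P12 W\<^sub>i P12 W\<^bsub>i-1\<^esub> \<dots> P12 W\<^sub>1\<close>.\<close>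

fun swapped_prod :: "(nat \<Rightarrow> complex ^ 2 ^ 2) \<Rightarrow> nat \<Rightarrow> complex ^ 2 ^ 2" where
  "swapped_prod W 0 = mat 1"
| "swapped_prod W (Suc i) = P12 ** W (Suc i) ** swapped_prod W i"

text \<open>The entries of \<open>(W\<^sub>i P12 W\<^bsub>i-1\<^esub> \<dots> P12 W\<^sub>1) x\<close> for \<open>1 \<le> i < L\<close>.\<close>

definition hidden_form :: "(nat \<Rightarrow> complex ^ 2 ^ 2) \<Rightarrow> nat \<Rightarrow> 2 \<Rightarrow> bipoly" where
  "hidden_form W i j = linear_form (row j (W i ** swapped_prod W (i - 1)))"

text \<open>The entries of \<open>(V P12 W\<^bsub>L-1\<^esub> \<dots> P12 W\<^sub>1) x\<close>.\<close>

definition output_form ::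
  "nat \<Rightarrow> (nat \<Rightarrow> complex ^ 2 ^ 2) \<Rightarrow> complex ^ 2 ^ 'k \<Rightarrow> 'k::finite \<Rightarrow> bipoly" where
  "output_form L W V j = linear_form (row j (V ** swapped_prod W (L - 1)))"

fun q_form :: "(nat \<Rightarrow> complex ^ 2 ^ 2) \<Rightarrow> nat \<Rightarrow> bipoly" where
  "q_form W 0 = 1"
| "q_form W (Suc 0) = 1"
| "q_form W (Suc (Suc i)) = hidden_form W (Suc i) 1 * hidden_form W (Suc i) 2"

text \<open>The product \<open>q\<^sub>n q\<^bsub>n-2\<^esub> \<dots>\<close>, ending in \<open>q\<^sub>0\<close> or \<open>q\<^sub>1\<close> according to the parity of \<open>n\<close>.\<close>

definition q_prod :: "(nat \<Rightarrow> complex ^ 2 ^ 2) \<Rightarrow> nat \<Rightarrow> bipoly" where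
  "q_prod W n = (\<Prod>j \<le> n div 2. q_form W (n - 2 * j))"

definition numerators ::
  "nat \<Rightarrow> (nat \<Rightarrow> complex ^ 2 ^ 2) \<Rightarrow> complex ^ 2 ^ 'k \<Rightarrow> bipoly ^ 'k::finite" where
  "numerators L W V = (\<chi> j. output_form L W V j * q_prod W (L - 1))"

definition denominator :: "nat \<Rightarrow> (nat \<Rightarrow> complex ^ 2 ^ 2) \<Rightarrow> bipoly" where
  "denominator L W = q_prod W L"

definition num_degree :: "nat \<Rightarrow> nat" where
  "num_degree L = L + L mod 2 - 1"

definition den_degree :: "nat \<Rightarrow> nat" where
  "den_degree L = L - L mod 2"

definition ambient_space :: "nat \<Rightarrow> ((bipoly ^ 'k::finite) \<times> bipoly) set" where
  "ambient_space L =
     {P. \<forall>j. P $ j \<in> binary_forms (num_degree L)} \<times> binary_forms (den_degree L)"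

definition neuromanifold :: "nat \<Rightarrow> ((bipoly ^ 'k::finite) \<times> bipoly) set" where
  "neuromanifold L = {(numerators L W V, denominator L W) | W V. True}"

text \<open>
  Complex polynomial functions in the coefficients of a tuple of forms. On an ambient space of
  forms of fixed degrees, the coefficients at monomials of any other degree vanish, so these
  restrict to the usual polynomial functions on a finite-dimensional vector space.
\<close>

inductive polynomial_fun :: "((bipoly ^ 'k::finite) \<times> bipoly \<Rightarrow> complex) \<Rightarrow> bool" where
  const: "polynomial_fun (\<lambda>_. c)"
| num_coeff: "polynomial_fun (\<lambda>v. Poly_Mapping.lookup (fst v $ j) k)"
| den_coeff: "polynomial_fun (\<lambda>v. Poly_Mapping.lookup (snd v) k)"
| add: "polynomial_fun f \<Longrightarrow> polynomial_fun g \<Longrightarrow> polynomial_fun (\<lambda>v. f v + g v)"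
| mult: "polynomial_fun f \<Longrightarrow> polynomial_fun g \<Longrightarrow> polynomial_fun (\<lambda>v. f v * g v)"

definition zariski_closed :: "nat \<Rightarrow> ((bipoly ^ 'k::finite) \<times> bipoly) set \<Rightarrow> bool" where
  "zariski_closed L Z \<longleftrightarrow>
     (\<exists>F. (\<forall>f \<in> F. polynomial_fun f) \<and> Z = {v \<in> ambient_space L. \<forall>f \<in> F. f v = 0})"

definition neurovariety :: "nat \<Rightarrow> ((bipoly ^ 'k::finite) \<times> bipoly) set" where
  "neurovariety L = zariski_closed L hull neuromanifold L"

end

theory Submission
  imports Defs "HOL-Computational_Algebra.Fundamental_Theorem_Algebra"
begin

text \<open>
  The entrywise inverse only swaps and rescales its two inputs, so the forms \<open>p\<^sub>i\<close> of layer \<open>i\<close> have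
  coefficient matrix \<open>A\<^sub>i = W\<^sub>i P12 W\<^bsub>i-1\<^esub> \<dots> P12 W\<^sub>1\<close>. As long as all earlier \<open>A\<^sub>i\<close> are invertible,
  the next one can be prescribed freely through its last factor \<open>W\<^sub>i\<close>; so every choice of invertible
  matrices \<open>A\<^sub>1, \<dots>, A\<^bsub>L-1\<^esub>\<close> and of an output row \<open>v\<close> is realized by weights
  (\<open>weights_of_invertible_layers\<close>). The numerator is then the product of the form of \<open>v\<close> and the row
  forms of \<open>A\<^bsub>L-2\<^esub>, A\<^bsub>L-4\<^esub>, \<dots>\<close>, and the denominator is the product of the row forms of
  \<open>A\<^bsub>L-1\<^esub>, A\<^bsub>L-3\<^esub>, \<dots>\<close>. The two products share no layer, and their numbers of factors are the
  two degrees of the ambient space.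

  Over the complex numbers every binary form of positive degree is a product of linear forms. Hence
  every point of the ambient space is given by some matrices \<open>A\<^sub>i\<close> and some \<open>v\<close>, where the \<open>A\<^sub>i\<close> may
  be singular (\<open>ambient_space_eq_layer_point\<close>). Replacing \<open>A\<^sub>i\<close> by \<open>A\<^sub>i + t I\<close> makes all of them
  invertible for small \<open>t \<noteq> 0\<close>, so the point is a limit of points of the neuromanifold. A
  polynomial function that vanishes on the neuromanifold is continuous along this curve, and so it
  vanishes at the point as well (\<open>polynomial_fun_vanishes_at_layer_point\<close>).
\<close>

section \<open>Binary forms\<close>

lemma lookup_single_mult:
  fixes g :: bipoly
  shows "Poly_Mapping.lookup (Poly_Mapping.single m c * g) k =
    c * (\<Sum>q. Poly_Mapping.lookup g q when k = m + q)"
  by (simp add: lookup_mult lookup_single when_mult)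

lemma lookup_linear_form_mult:
  "Poly_Mapping.lookup (linear_form r * g) (a, b) =
    (if a = 0 then 0 else r $ 1 * Poly_Mapping.lookup g (a - 1, b)) +
    (if b = 0 then 0 else r $ 2 * Poly_Mapping.lookup g (a, b - 1))"
proof -
  have *: "(a, b) = (1, 0) + q \<longleftrightarrow> a \<noteq> 0 \<and> q = (a - 1, b)"
       "(a, b) = (0, 1) + q \<longleftrightarrow> b \<noteq> 0 \<and> q = (a, b - 1)" for q
    by (cases q; auto)+
  have 1: "(\<Sum>q. Poly_Mapping.lookup g q when (a, b) = (1, 0) + q) =
      (if a = 0 then 0 else Poly_Mapping.lookup g (a - 1, b))"
    unfolding * by (cases "a = 0") simp_all
  have 2: "(\<Sum>q. Poly_Mapping.lookup g q when (a, b) = (0, 1) + q) =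
      (if b = 0 then 0 else Poly_Mapping.lookup g (a, b - 1))"
    unfolding * by (cases "b = 0") simp_all
  show ?thesis
    unfolding linear_form_def distrib_right lookup_add lookup_single_mult 1 2 by simp
qed

lemma binary_forms_iff_lookup:
  "f \<in> binary_forms d \<longleftrightarrow> (\<forall>a b. a + b \<noteq> d \<longrightarrow> Poly_Mapping.lookup f (a, b) = 0)"
  unfolding binary_forms_def mem_Collect_eq Ball_def in_keys_iff split_paired_All fst_conv snd_conv
  by blast

lemma linear_form_in_binary_forms: "linear_form r \<in> binary_forms 1"
  by (auto simp: binary_forms_iff_lookup linear_form_def lookup_add lookup_single when_def)

lemma one_in_binary_forms: "1 \<in> binary_forms 0"
  by (simp add: binary_forms_def)

lemma mult_in_binary_forms:
  assumes "f \<in> binary_forms d" "g \<in> binary_forms e"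
  shows "f * g \<in> binary_forms (d + e)"
  using assms keys_mult[of f g] by (fastforce simp: binary_forms_def)

text \<open>
  The coefficients of \<open>h\<close> above degree \<open>d\<close> are dropped. If \<open>h\<close> has degree less than \<open>d\<close>, the form
  is divisible by the second variable: the root of the form at infinity.
\<close>

definition homogenize :: "nat \<Rightarrow> complex poly \<Rightarrow> bipoly" where
  "homogenize d h = (\<Sum>i\<le>d. Poly_Mapping.single (i, d - i) (coeff h i))"

lemma lookup_homogenize:
  "Poly_Mapping.lookup (homogenize d h) (a, b) = (if a + b = d then coeff h a else 0)"
proof -
  have "Poly_Mapping.lookup (homogenize d h) (a, b) =
      (\<Sum>i\<le>d. if i = a then (if a + b = d then coeff h a else 0) else 0)"
    unfolding homogenize_def lookup_sum
    by (intro sum.cong) (auto simp: lookup_single when_def)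
  then show ?thesis by (auto simp: sum.delta)
qed

lemma binary_form_eq_homogenize:
  assumes "f \<in> binary_forms d"
  obtains h where "degree h \<le> d" "f = homogenize d h"
proof
  define h where "h = (\<Sum>i\<le>d. monom (Poly_Mapping.lookup f (i, d - i)) i)"
  show "degree h \<le> d"
    unfolding h_def by (intro degree_sum_le) (auto intro: order_trans[OF degree_monom_le])
  have "coeff h a = (if a \<le> d then Poly_Mapping.lookup f (a, d - a) else 0)" for a
    by (auto simp: h_def coeff_sum sum.delta)
  then show "f = homogenize d h"
    using assms
    by (intro poly_mapping_eqI) (auto simp: lookup_homogenize binary_forms_iff_lookup)
qed

text \<open>
  The bound on the degree guarantees that \<open>homogenize d\<close> loses no coefficient of \<open>h\<close>; otherwise the
  coefficient of \<open>x\<^sub>1\<^bsup>d+1\<^esup>\<close> could differ.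
\<close>

lemma homogenize_linear_mult:
  assumes "degree h \<le> d"
  shows "homogenize (Suc d) ([:r $ 2, r $ 1:] * h) = linear_form r * homogenize d h"
proof (rule poly_mapping_eqI, clarify)
  fix a b
  have "coeff h (Suc d) = 0" using assms by (simp add: coeff_eq_0)
  then show "Poly_Mapping.lookup (homogenize (Suc d) ([:r $ 2, r $ 1:] * h)) (a, b) =
      Poly_Mapping.lookup (linear_form r * homogenize d h) (a, b)"
    by (cases a; cases b) (auto simp: lookup_linear_form_mult lookup_homogenize)
qed

text \<open>
  This is the fundamental theorem of algebra on the projective line: the dehomogenized polynomial has
  a root, unless its degree drops and the form has a root at infinity.
\<close>

lemma binary_form_linear_factor:
  assumes "f \<in> binary_forms (Suc d)"
  obtains r g where "g \<in> binary_forms d" "f = linear_form r * g"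
proof -
  obtain h where h: "degree h \<le> Suc d" "f = homogenize (Suc d) h"
    using binary_form_eq_homogenize[OF assms] .
  have "\<exists>r g. degree g \<le> d \<and> h = [:r $ 2, (r :: complex^2) $ 1:] * g"
  proof (cases "degree h \<le> d")
    case True
    \<comment> \<open>The factor is the second variable, whose dehomogenization is \<open>1\<close>.\<close>
    show ?thesis
      by (rule exI[of _ "vector [0, 1]"], rule exI[of _ h]) (use True in simp)
  next
    case False
    then obtain z where "poly h z = 0"
      using fundamental_theorem_of_algebra[of h] by (auto simp: constant_degree)
    then obtain g where g: "h = [:- z, 1:] * g"
      by (auto simp: poly_eq_0_iff_dvd)
    with False have "g \<noteq> 0" by auto
    then have "degree h = Suc (degree g)"
      unfolding g by (subst degree_mult_eq) auto
    with h(1) g show ?thesis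
      by (intro exI[of _ "vector [1, - z]"] exI[of _ g]) simp
  qed
  then obtain r g where "degree g \<le> d" "h = [:r $ 2, (r :: complex^2) $ 1:] * g" by blast
  then have "f = linear_form r * homogenize d g"
    using h homogenize_linear_mult by simp
  moreover have "homogenize d g \<in> binary_forms d"
    by (simp add: binary_forms_iff_lookup lookup_homogenize)
  ultimately show ?thesis using that by blast
qed

lemma binary_form_1_linear:
  assumes "f \<in> binary_forms 1"
  obtains r where "f = linear_form r"
proof
  show "f = linear_form (vector [Poly_Mapping.lookup f (1, 0), Poly_Mapping.lookup f (0, 1)])"
    (is "f = linear_form ?r")
  proof (rule poly_mapping_eqI, clarify)
    fix a b :: nat
    have "a + b \<noteq> 1 \<or> (a, b) = (1, 0) \<or> (a, b) = (0, 1)" by auto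
    then show "Poly_Mapping.lookup f (a, b) = Poly_Mapping.lookup (linear_form ?r) (a, b)"
      using assms linear_form_in_binary_forms[of ?r]
      by (auto simp: binary_forms_iff_lookup linear_form_def lookup_add lookup_single when_def)
  qed
qed

section \<open>Networks parametrized by their layer products\<close>

text \<open>
  This is \<open>q_prod\<close> with the coefficient matrices \<open>A\<^sub>i\<close> of the layers as parameters in place of the
  weights, so that the layers become independent of each other.
\<close>

fun row_prod :: "(nat \<Rightarrow> complex ^ 2 ^ 2) \<Rightarrow> nat \<Rightarrow> bipoly" where
  "row_prod A 0 = 1"
| "row_prod A (Suc 0) = 1"
| "row_prod A (Suc (Suc n)) =
     linear_form (row 1 (A (Suc n))) * (linear_form (row 2 (A (Suc n))) * row_prod A n)"

text \<open>
  Only every other layer enters. This is what makes numerator and denominator independent.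
\<close>

lemma row_prod_cong:
  assumes "\<And>i. i < n \<Longrightarrow> even i \<noteq> even n \<Longrightarrow> A i = B i"
  shows "row_prod A n = row_prod B n"
  using assms by (induction A n rule: row_prod.induct) auto

lemma row_prod_in_binary_forms: "row_prod A n \<in> binary_forms (2 * (n div 2))"
proof (induction A n rule: row_prod.induct)
  case (3 A n)
  then show ?case
    using mult_in_binary_forms[OF linear_form_in_binary_forms
        mult_in_binary_forms[OF linear_form_in_binary_forms 3]]
    by simp
qed (auto simp: one_in_binary_forms)

lemma q_prod_Suc_Suc: "q_prod W (Suc (Suc n)) = q_form W (Suc (Suc n)) * q_prod W n"
  unfolding q_prod_def by (simp add: prod.atMost_Suc_shift del: prod.atMost_Suc)

lemma q_prod_eq_row_prod:
  "q_prod W n = row_prod (\<lambda>i. W i ** swapped_prod W (i - 1)) n"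
proof (induction n rule: nat_induct2)
  case (step n)
  then show ?case by (simp add: q_prod_Suc_Suc hidden_form_def mult.assoc)
qed (simp_all add: q_prod_def)

lemma P12_mult_P12: "P12 ** P12 = mat 1"
  by (simp add: P12_def matrix_matrix_mult_def mat_def vec_eq_iff forall_2 sum_2)

lemma invertible_P12: "invertible P12"
  using P12_mult_P12 by (auto simp: invertible_def)

lemma matrix_inv_mult:
  fixes A :: "'a::semiring_1 ^ 'n ^ 'm"
  assumes "invertible A"
  shows "matrix_inv A ** A = mat 1"
  using someI_ex[OF assms[unfolded invertible_def]] by (simp add: matrix_inv_def)

text \<open>
  The matrices are prescribed one layer after the other: \<open>W\<^sub>i\<close> undoes the product of the layers before
  it and then applies \<open>A\<^sub>i\<close>. Only earlier products get inverted, so the output matrix \<open>V\<close> is arbitrary.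
\<close>

lemma weights_of_invertible_layers:
  fixes V :: "complex ^ 2 ^ 'k"
  assumes "\<And>i. 1 \<le> i \<Longrightarrow> i < L \<Longrightarrow> invertible (A i)"
  obtains W V' where "\<And>i. 1 \<le> i \<Longrightarrow> i < L \<Longrightarrow> W i ** swapped_prod W (i - 1) = A i"
    "V' ** swapped_prod W (L - 1) = V"
proof -
  \<comment> \<open>The value that \<open>swapped_prod W i\<close> is going to have.\<close>
  define B where "B i = (if i = 0 then mat 1 else P12 ** A i)" for i
  define W where "W i = A i ** matrix_inv (B (i - 1))" for i
  have "invertible (mat 1 :: complex ^ 2 ^ 2)" by (auto simp: invertible_def)
  then have inv: "invertible (B i)" if "i < L" for i
    using that assms by (auto simp: B_def invertible_P12 invertible_mult)
  have cancel: "M ** matrix_inv (B i) ** B i = M" if "i < L" for i and M :: "complex ^ 2 ^ 'm"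
    using matrix_inv_mult[OF inv[OF that]] by (simp flip: matrix_mul_assoc)
  have swapped: "swapped_prod W i = B i" if "i < L" for i
    using that
  proof (induction i)
    case (Suc i)
    have "W (Suc i) = A (Suc i) ** matrix_inv (B i)" by (simp add: W_def)
    with Suc have "W (Suc i) ** swapped_prod W i = A (Suc i)"
      using cancel[of i "A (Suc i)"] by simp
    then show ?case by (simp add: B_def flip: matrix_mul_assoc)
  qed (simp add: B_def)
  have "W i ** swapped_prod W (i - 1) = A i" if "1 \<le> i" "i < L" for i
    using that swapped[of "i - 1"] cancel[of "i - 1" "A i"] by (simp add: W_def)
  moreover have "\<exists>V'. V' ** swapped_prod W (L - 1) = V"
  proof (cases "L = 0")
    case True
    then show ?thesis by (auto intro: exI[of _ V])
  next
    case False
    then show ?thesis using swapped[of "L - 1"] cancel[of "L - 1" V] by auto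
  qed
  ultimately show ?thesis using that by blast
qed

text \<open>
  The pair of numerator and denominator of a network whose layers have the coefficient matrices \<open>A\<^sub>i\<close>
  and whose output is the linear form of \<open>v\<close>. It makes sense for singular \<open>A\<^sub>i\<close> too, where it need not
  come from any weights.
\<close>

definition layer_point :: "nat \<Rightarrow> (nat \<Rightarrow> complex ^ 2 ^ 2) \<Rightarrow> complex ^ 2 \<Rightarrow> (bipoly ^ 1) \<times> bipoly"
  where "layer_point L A v = (\<chi> j. linear_form v * row_prod A (L - 1), row_prod A L)"

lemma layer_point_in_neuromanifold:
  assumes "\<And>i. 1 \<le> i \<Longrightarrow> i < L \<Longrightarrow> invertible (A i)"
  shows "layer_point L A v \<in> neuromanifold L"
proof -
  obtain W V' where W: "\<And>i. 1 \<le> i \<Longrightarrow> i < L \<Longrightarrow> W i ** swapped_prod W (i - 1) = A i"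
    and V: "V' ** swapped_prod W (L - 1) = (\<chi> j::1. v)"
    using weights_of_invertible_layers[of L A "\<chi> j::1. v"] assms by blast
  have q: "q_prod W n = row_prod A n" if "n \<le> L" for n
  proof -
    have "row_prod (\<lambda>i. W i ** swapped_prod W (i - 1)) n = row_prod A n"
      if "n \<le> L" for n using that
      by (induction n rule: nat_induct2) (use W[of "Suc _"] in auto)
    with that show ?thesis by (simp add: q_prod_eq_row_prod)
  qed
  have "row j (V' ** swapped_prod W (L - 1)) = v" for j
    unfolding V by (simp add: row_def vec_eq_iff)
  then have "numerators L W V' = (\<chi> j. linear_form v * row_prod A (L - 1))"
    by (simp add: numerators_def output_form_def q)
  moreover have "denominator L W = row_prod A L" by (simp add: denominator_def q)
  ultimately show ?thesis unfolding neuromanifold_def layer_point_def mem_Collect_eq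
    by (intro exI[of _ W] exI[of _ V']) simp
qed

section \<open>Every pair of forms comes from possibly degenerate layer products\<close>

text \<open>
  Two linear factors at a time are split off and made the rows of the topmost layer. The one factor
  that remains in the end becomes the output form.
\<close>

lemma odd_form_row_prod:
  assumes "f \<in> binary_forms (Suc (2 * (n div 2)))"
  shows "\<exists>v A. f = linear_form v * row_prod A n"
  using assms
proof (induction n arbitrary: f rule: nat_induct2)
  case (step n)
  then have "f \<in> binary_forms (Suc (Suc (Suc (2 * (n div 2)))))" by simp
  then obtain r1 r2 g where f: "f = linear_form r1 * (linear_form r2 * g)"
    and g: "g \<in> binary_forms (Suc (2 * (n div 2)))"
    by (metis binary_form_linear_factor)
  obtain v A where vA: "g = linear_form v * row_prod A n" using step.IH[OF g] by blast
  define A' where "A' = A(Suc n := vector [r1, r2])"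
  have "row 1 (A' (Suc n)) = r1" "row 2 (A' (Suc n)) = r2"
    by (simp_all add: A'_def row_def vec_eq_iff)
  moreover have "row_prod A' n = row_prod A n" by (rule row_prod_cong) (simp add: A'_def)
  ultimately have "f = linear_form v * row_prod A' (n + 2)"
    by (simp add: f vA mult_ac)
  then show ?case by blast
qed (simp_all, (metis One_nat_def binary_form_1_linear)+)

text \<open>
  A form of degree \<open>0\<close> may be a constant other than \<open>1\<close>, so \<open>n\<close> has to be at least \<open>2\<close>: there must be
  a linear factor to absorb scalars. After one factor is split off, the odd case applies, and its
  output form becomes the second row of the topmost layer.
\<close>

lemma even_form_row_prod:
  assumes "f \<in> binary_forms (2 * (n div 2))" "n \<ge> 2"
  shows "\<exists>A. f = row_prod A n"
proof -
  obtain m where n: "n = Suc (Suc m)" using assms(2) by (metis add_2_eq_Suc le_Suc_ex)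
  then have "f \<in> binary_forms (Suc (Suc (2 * (m div 2))))" using assms(1) by simp
  then obtain r g where f: "f = linear_form r * g"
    and g: "g \<in> binary_forms (Suc (2 * (m div 2)))"
    by (rule binary_form_linear_factor)
  obtain v A where vA: "g = linear_form v * row_prod A m" using odd_form_row_prod[OF g] by blast
  define A' where "A' = A(Suc m := vector [r, v])"
  have "row 1 (A' (Suc m)) = r" "row 2 (A' (Suc m)) = v"
    by (simp_all add: A'_def row_def vec_eq_iff)
  moreover have "row_prod A' m = row_prod A m" by (rule row_prod_cong) (simp add: A'_def)
  ultimately have "f = row_prod A' n" by (simp add: f vA n)
  then show ?thesis by blast
qed

lemma degrees_div:
  assumes "L \<ge> 1"
  shows "num_degree L = Suc (2 * ((L - 1) div 2))" "den_degree L = 2 * (L div 2)"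
  using assms unfolding num_degree_def den_degree_def by presburger+

lemma ambient_space_eq_layer_point:
  assumes "L \<ge> 2" "p \<in> ambient_space L"
  obtains A v where "p = layer_point L A v"
proof -
  obtain P Q where p: "p = (P, Q)" by force
  have "P $ 1 \<in> binary_forms (Suc (2 * ((L - 1) div 2)))" "Q \<in> binary_forms (2 * (L div 2))"
    using assms by (auto simp: p ambient_space_def degrees_div)
  then obtain v A B where P: "P $ 1 = linear_form v * row_prod A (L - 1)"
    and Q: "Q = row_prod B L"
    using odd_form_row_prod even_form_row_prod[OF _ assms(1)] by blast
  \<comment> \<open>The numerator reads the layers of the parity of \<open>L\<close>, the denominator those of the other parity.\<close>
  define C where "C i = (if even i = even L then A i else B i)" for i
  have "row_prod C (L - 1) = row_prod A (L - 1)" "row_prod C L = row_prod B L"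
    using assms(1) by (auto intro!: row_prod_cong simp: C_def split: if_splits)
  then have "p = layer_point L C v"
    by (simp add: p layer_point_def P Q vec_eq_iff forall_1)
  then show ?thesis using that by blast
qed

section \<open>Degeneration\<close>

lemma eventually_invertible_add_mat:
  fixes M :: "complex ^ 2 ^ 2"
  shows "eventually (\<lambda>t. invertible (M + mat t)) (at 0)"
proof -
  \<comment> \<open>The characteristic polynomial of \<open>- M\<close>.\<close>
  define p where "p = [:M $ 1 $ 1 * M $ 2 $ 2 - M $ 1 $ 2 * M $ 2 $ 1, M $ 1 $ 1 + M $ 2 $ 2, 1:]"
  have "det (M + mat t) = poly p t" for t
    by (simp add: det_2 mat_def p_def algebra_simps)
  moreover have "finite {t. poly p t = 0}" by (rule poly_roots_finite) (simp add: p_def)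
  then have "eventually (\<lambda>t. t \<notin> {t. poly p t = 0}) (at 0)"
    using islimpt_finite islimpt_iff_eventually by blast
  ultimately show ?thesis by (simp add: invertible_det_nz)
qed

lemma isCont_polynomial_fun:
  assumes "polynomial_fun f"
    and "\<And>j k. isCont (\<lambda>t. Poly_Mapping.lookup (fst (\<gamma> t) $ j) k) a"
    and "\<And>k. isCont (\<lambda>t. Poly_Mapping.lookup (snd (\<gamma> t)) k) a"
  shows "isCont (\<lambda>t. f (\<gamma> t)) a"
  using assms(1) by induction (auto intro!: continuous_intros assms(2,3))

lemma isCont_lookup_linear_form_mult:
  assumes "\<And>j. isCont (\<lambda>t. r t $ j) a" "\<And>k. isCont (\<lambda>t. Poly_Mapping.lookup (g t) k) a"
  shows "isCont (\<lambda>t. Poly_Mapping.lookup (linear_form (r t) * g t) k) a"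
proof (cases k)
  case (Pair m n)
  then show ?thesis unfolding Pair lookup_linear_form_mult
    by (cases "m = 0"; cases "n = 0") (auto intro!: continuous_intros assms)
qed

lemma isCont_lookup_row_prod:
  assumes "\<And>i j l. isCont (\<lambda>t. A t i $ j $ l) a"
  shows "isCont (\<lambda>t. Poly_Mapping.lookup (row_prod (A t) n) k) a"
proof (induction n arbitrary: k rule: nat_induct2)
  case (step n)
  then show ?case
    by (auto intro!: isCont_lookup_linear_form_mult assms simp: row_def)
qed auto

text \<open>
  The point is approached along the curve with layers \<open>A\<^sub>i + t I\<close>. For each layer only finitely many
  \<open>t\<close> give a singular matrix, so the curve lies in the neuromanifold for all small \<open>t \<noteq> 0\<close>.
\<close>

lemma polynomial_fun_vanishes_at_layer_point:
  assumes f: "polynomial_fun f" and 0: "\<And>p. p \<in> neuromanifold L \<Longrightarrow> f p = 0"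
  shows "f (layer_point L A v) = 0"
proof -
  define \<gamma> where "\<gamma> t = layer_point L (\<lambda>i. A i + mat t) v" for t
  have "isCont (\<lambda>t. (A i + mat t) $ j $ l) 0" for i j l
    by (cases "j = l") (auto simp: mat_def intro!: continuous_intros)
  then have "isCont (\<lambda>t. f (\<gamma> t)) 0"
    unfolding \<gamma>_def layer_point_def
    by (intro isCont_polynomial_fun[OF f])
      (auto intro!: isCont_lookup_row_prod isCont_lookup_linear_form_mult)
  then have "(\<lambda>t. f (\<gamma> t)) \<midarrow>0\<rightarrow> f (\<gamma> 0)" by (simp add: isCont_def)
  moreover have "eventually (\<lambda>t. \<forall>i\<in>{..<L}. invertible (A i + mat t)) (at 0)"
    by (intro eventually_ball_finite ballI eventually_invertible_add_mat) simp
  then have "eventually (\<lambda>t. f (\<gamma> t) = 0) (at 0)"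
    by eventually_elim (auto simp: \<gamma>_def intro!: 0 layer_point_in_neuromanifold)
  then have "(\<lambda>t. f (\<gamma> t)) \<midarrow>0\<rightarrow> 0" by (rule tendsto_eventually)
  ultimately have "f (\<gamma> 0) = 0" by (rule tendsto_unique[OF at_neq_bot])
  moreover have "\<gamma> 0 = layer_point L A v"
    by (simp add: \<gamma>_def)
  ultimately show ?thesis by simp
qed

section \<open>The closure\<close>

lemma neuromanifold_subset_ambient_space:
  assumes "L \<ge> 1"
  shows "(neuromanifold L :: ((bipoly ^ 'k::finite) \<times> bipoly) set) \<subseteq> ambient_space L"
proof -
  have "linear_form r * row_prod A (L - 1) \<in> binary_forms (num_degree L)" for r A
    using mult_in_binary_forms[OF linear_form_in_binary_forms row_prod_in_binary_forms]
    by (simp add: degrees_div[OF assms])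
  moreover have "row_prod A L \<in> binary_forms (den_degree L)" for A
    using row_prod_in_binary_forms by (simp add: degrees_div[OF assms])
  ultimately show ?thesis
    by (auto simp: neuromanifold_def ambient_space_def numerators_def denominator_def
        output_form_def q_prod_eq_row_prod)
qed

theorem proposition5p6:
  fixes L :: nat
  assumes "L \<ge> 2"
  shows "(neurovariety L :: ((bipoly ^ 1) \<times> bipoly) set) =
    {P. P $ 1 \<in> binary_forms (num_degree L)} \<times> binary_forms (den_degree L)"
proof -
  let ?M = "neuromanifold L :: ((bipoly ^ 1) \<times> bipoly) set"
  have "zariski_closed L hull ?M = ambient_space L"
  proof (rule hull_unique)
    show "?M \<subseteq> ambient_space L"
      using assms by (intro neuromanifold_subset_ambient_space) simp
    show "zariski_closed L (ambient_space L :: ((bipoly ^ 1) \<times> bipoly) set)"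
      unfolding zariski_closed_def by (rule exI[of _ "{}"]) simp
  next
    fix Z assume "?M \<subseteq> Z" "zariski_closed L Z"
    then obtain F where F: "\<And>f. f \<in> F \<Longrightarrow> polynomial_fun f"
      and Z: "Z = {v \<in> ambient_space L. \<forall>f \<in> F. f v = 0}"
      unfolding zariski_closed_def by blast
    have "f p = 0" if p: "p \<in> ambient_space L" and f: "f \<in> F" for p f
    proof -
      obtain A v where "p = layer_point L A v"
        using ambient_space_eq_layer_point[OF assms p] .
      moreover have "f (layer_point L A v) = 0"
      proof (rule polynomial_fun_vanishes_at_layer_point)
        show "polynomial_fun f" using F f .
        show "f q = 0" if "q \<in> ?M" for q using \<open>?M \<subseteq> Z\<close> that f by (auto simp: Z)
      qed
      ultimately show ?thesis by simp
    qed
    then show "ambient_space L \<subseteq> Z" by (auto simp: Z)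
  qed
  then show ?thesis
    by (simp add: neurovariety_def ambient_space_def forall_1)
qed

end
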